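(* Let $n\ge 2$ be an integer and let $SD_{8n}=\langle a,b : a^{4n}=b^2=1,\ bab^{-1}=a^{2n-1}\rangle$ be the semidihedral group. Then $\mathrm{OSCom}(SD_{8n})\cong K_{8n}$.
   Context: For a finite group $G$, the order super commuting graph $\mathrm{OSCom}(G)$ is the simple graph with vertex set $G$ in which two distinct vertices $g,h$ are adjacent if and only if either $g$ and $h$ have the same order, or there exist $g',h'\in G$ such that $g'$ has the same order as $g$, $h'$ has the same order as $h$, and $g'h'=h'g'$. $K_r$ is the complete graph on $r$ vertices. *)

theory Defs
  imports "HOL-Algebra.Multiplicative_Group" "Graph_Theory.Graph_Theory"
begin

section \<open>Groups given by generators and relations\<close>

text \<open>The generators are all the elements of the type of letters; the letter \<open>(x, True)\<close> stands
  for the generator \<open>x\<close> and \<open>(x, False)\<close> for its formal inverse. A relation \<open>u = v\<close> is the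
  pair \<open>(u, v)\<close>.\<close>

type_synonym 'g word = "('g \<times> bool) list"

inductive word_cong :: "('g word \<times> 'g word) set \<Rightarrow> 'g word \<Rightarrow> 'g word \<Rightarrow> bool"
  for R :: "('g word \<times> 'g word) set" where
  cancel: "word_cong R [(x, s), (x, \<not> s)] []"
| rel: "(u, v) \<in> R \<Longrightarrow> word_cong R u v"
| refl: "word_cong R u u"
| sym: "word_cong R u v \<Longrightarrow> word_cong R v u"
| trans: "word_cong R u v \<Longrightarrow> word_cong R v w \<Longrightarrow> word_cong R u w"
| append: "word_cong R u u' \<Longrightarrow> word_cong R v v' \<Longrightarrow> word_cong R (u @ v) (u' @ v')"

definition word_class :: "('g word \<times> 'g word) set \<Rightarrow> 'g word \<Rightarrow> 'g word set" where
  "word_class R u = {v. word_cong R u v}"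

definition presented_group :: "('g word \<times> 'g word) set \<Rightarrow> 'g word set monoid" where
  "presented_group R =
    \<lparr>carrier = range (word_class R),
     monoid.mult = (\<lambda>A B. {w. \<exists>u\<in>A. \<exists>v\<in>B. word_cong R (u @ v) w}),
     one = word_class R []\<rparr>"

lemma word_class_eq_iff: "word_class R u = word_class R v \<longleftrightarrow> word_cong R u v"
  unfolding word_class_def set_eq_iff mem_Collect_eq
  by (meson word_cong.refl word_cong.sym word_cong.trans)

lemma presented_group_simps:
  "carrier (presented_group R) = range (word_class R)"
  "word_class R u \<otimes>\<^bsub>presented_group R\<^esub> word_class R v = word_class R (u @ v)"
  "\<one>\<^bsub>presented_group R\<^esub> = word_class R []"
proof -
  show "word_class R u \<otimes>\<^bsub>presented_group R\<^esub> word_class R v = word_class R (u @ v)"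
  proof (rule Set.set_eqI)
    fix w
    have "word_cong R (u @ v) w"
      if "word_cong R u u'" "word_cong R v v'" "word_cong R (u' @ v') w" for u' v'
      using that by (rule word_cong.trans[OF word_cong.append])
    then show "w \<in> word_class R u \<otimes>\<^bsub>presented_group R\<^esub> word_class R v \<longleftrightarrow>
        w \<in> word_class R (u @ v)"
      unfolding presented_group_def word_class_def
      by (simp only: monoid.simps mem_Collect_eq Bex_def) (meson word_cong.refl)
  qed
qed (simp_all add: presented_group_def)

definition word_inv :: "'g word \<Rightarrow> 'g word" where
  "word_inv u = rev (map (\<lambda>(x, s). (x, \<not> s)) u)"

lemma word_cong_inv_left: "word_cong R (word_inv u @ u) []"
proof (induction u)
  case (Cons p u)
  obtain x s where p: "p = (x, s)" by force
  have "word_cong R [(x, \<not> s), (x, s)] []"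
    using word_cong.cancel[of R x "\<not> s"] by simp
  then have "word_cong R (word_inv u @ [(x, \<not> s), (x, s)] @ u) (word_inv u @ [] @ u)"
    by (intro word_cong.append word_cong.refl)
  then show ?case
    using Cons.IH by (auto simp: word_inv_def p intro: word_cong.trans)
qed (simp add: word_inv_def word_cong.refl)

lemma group_presented_group: "group (presented_group R)"
proof (rule groupI)
  fix X assume "X \<in> carrier (presented_group R)"
  then obtain u where X: "X = word_class R u"
    by (auto simp: presented_group_simps)
  have "word_class R (word_inv u) \<otimes>\<^bsub>presented_group R\<^esub> X = \<one>\<^bsub>presented_group R\<^esub>"
    by (simp add: X presented_group_simps word_class_eq_iff word_cong_inv_left)
  then show "\<exists>Y\<in>carrier (presented_group R). Y \<otimes>\<^bsub>presented_group R\<^esub> X = \<one>\<^bsub>presented_group R\<^esub>"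
    by (auto simp: presented_group_simps)
qed (auto simp: presented_group_simps)

primrec word_value :: "('h, 'm) monoid_scheme \<Rightarrow> ('g \<Rightarrow> 'h) \<Rightarrow> 'g word \<Rightarrow> 'h" where
  "word_value H f [] = \<one>\<^bsub>H\<^esub>"
| "word_value H f (p # u) = (if snd p then f (fst p) else inv\<^bsub>H\<^esub> f (fst p)) \<otimes>\<^bsub>H\<^esub> word_value H f u"

context group begin

lemma word_value_closed [simp]: "range f \<subseteq> carrier G \<Longrightarrow> word_value G f u \<in> carrier G"
  by (induction u) auto

lemma word_value_append:
  "range f \<subseteq> carrier G \<Longrightarrow> word_value G f (u @ v) = word_value G f u \<otimes> word_value G f v"
proof (induction u)
  case (Cons p u)
  have "f (fst p) \<in> carrier G"
    using Cons.prems by auto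
  then show ?case
    using Cons by (auto simp: m_assoc)
qed simp

lemma word_value_cong:
  assumes "word_cong R u v" and f: "range f \<subseteq> carrier G"
    and "\<And>u v. (u, v) \<in> R \<Longrightarrow> word_value G f u = word_value G f v"
  shows "word_value G f u = word_value G f v"
  using assms(1)
proof induction
  case (cancel x s)
  have "f x \<in> carrier G"
    using f by auto
  then show ?case
    by simp
qed (use assms(3) f in \<open>auto simp: word_value_append\<close>)

text \<open>The universal property of the presentation.\<close>

lemma presented_group_hom:
  assumes f: "range f \<subseteq> carrier G"
    and R: "\<And>u v. (u, v) \<in> R \<Longrightarrow> word_value G f u = word_value G f v"
  obtains h where "h \<in> hom (presented_group R) G" "\<And>x. h (word_class R [(x, True)]) = f x"
proof -
  define h where "h C = word_value G f (SOME u. C = word_class R u)" for C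
  have h: "h (word_class R u) = word_value G f u" for u
  proof -
    have "word_class R u = word_class R (SOME v. word_class R u = word_class R v)"
      by (rule someI) (rule HOL.refl)
    then have "word_cong R u (SOME v. word_class R u = word_class R v)"
      by (simp only: word_class_eq_iff)
    from word_value_cong[OF this f R] show ?thesis
      by (simp add: h_def)
  qed
  have "f x \<in> carrier G" for x
    using f by auto
  then show thesis
    using f by (intro that[of h]) (auto simp: hom_def h presented_group_simps word_value_append)
qed

end

section \<open>The semidihedral group\<close>

datatype sd_gen = gen_a | gen_b

definition sd_relations :: "nat \<Rightarrow> (sd_gen word \<times> sd_gen word) set" where
  "sd_relations n =
    (let a = (gen_a, True); b = (gen_b, True); b' = (gen_b, False) in
      {(replicate (4 * n) a, []), (replicate 2 b, []),
       ([b, a, b'], replicate (2 * n - 1) a)})"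

definition semidihedral :: "nat \<Rightarrow> sd_gen word set monoid" where
  "semidihedral n = presented_group (sd_relations n)"

section \<open>The order super commuting graph\<close>

text \<open>As in \<open>Graph_Theory\<close>, a simple graph is a symmetric loop-free digraph.\<close>

definition OSCom :: "('a, 'b) monoid_scheme \<Rightarrow> 'a pair_pre_digraph" where
  "OSCom G =
    \<lparr>pverts = carrier G,
     parcs = {(g, h). g \<in> carrier G \<and> h \<in> carrier G \<and> g \<noteq> h \<and>
       (group.ord G g = group.ord G h \<or>
        (\<exists>g'\<in>carrier G. \<exists>h'\<in>carrier G. group.ord G g' = group.ord G g \<and>
           group.ord G h' = group.ord G h \<and> g' \<otimes>\<^bsub>G\<^esub> h' = h' \<otimes>\<^bsub>G\<^esub> g'))}\<rparr>"

lemma pair_graph_OSCom: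
  assumes "finite (carrier G)"
  shows "pair_graph (OSCom G)"
proof -
  have "finite (parcs (OSCom G))"
    by (rule finite_subset[of _ "carrier G \<times> carrier G"]) (auto simp: OSCom_def assms)
  moreover have "sym (parcs (OSCom G))"
    unfolding sym_def OSCom_def by (simp only: pair_pre_digraph.simps mem_Collect_eq prod.case) metis
  ultimately show ?thesis
    by unfold_locales (auto simp: symmetric_def OSCom_def assms)
qed

definition complete_graph :: "nat \<Rightarrow> nat pair_pre_digraph" where
  "complete_graph r =
    \<lparr>pverts = {..<r}, parcs = {(i, j). i < r \<and> j < r \<and> i \<noteq> j}\<rparr>"

lemma complete_digraph_complete_graph: "complete_digraph r (with_proj (complete_graph r))"
  by (auto simp: complete_digraph_pair_def complete_graph_def)

end

theory Submission
  imports Defs "HOL-Number_Theory.Cong"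
begin

text \<open>The order super commuting graph of a group \<open>G\<close> is complete as soon as some element \<open>a\<close> has
  powers of all the orders that occur in \<open>G\<close>: two arbitrary elements then share their orders with
  two powers of \<open>a\<close>, and these commute (\<open>parcs_OSCom_complete\<close>). In the semidihedral group every
  element is \<open>a\<^sup>i\<close> or \<open>a\<^sup>i b\<close>. From \<open>(a\<^sup>i b)\<^sup>2 = a\<^bsup>i + (2n-1)i\<^esup> = a\<^bsup>2ni\<^esup>\<close> and \<open>a\<^bsup>4n\<^esup> = 1\<close>
  the element \<open>a\<^sup>i b\<close> has order 2 for even \<open>i\<close> and order 4 for odd \<open>i\<close>, and \<open>a\<^bsup>2n\<^esup>\<close> and \<open>a\<^sup>n\<close> have
  these orders.

  What has to be earned is that the presentation does not collapse: the order computation needs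
  \<open>a\<^bsup>2n\<^esup> \<noteq> 1\<close> and \<open>a\<^sup>i b \<noteq> 1\<close>, and the graph needs exactly \<open>8n\<close> vertices. Both follow from the
  uniqueness of the normal form \<open>a\<^sup>i b\<^sup>s\<close> with \<open>i < 4n\<close> and \<open>s < 2\<close>
  (\<open>semidihedral_normal_form\<close>). The relations reduce every word to this form, and the
  homomorphism onto a semidirect product of cyclic groups of orders \<open>4n\<close> and 2, which the
  universal property of the presentation provides, reads off \<open>i\<close> and \<open>s\<close> again.\<close>

section \<open>Complete order super commuting graphs\<close>

text \<open>Powers of one element commute, so they serve as the commuting representatives \<open>g'\<close> and
  \<open>h'\<close> of any two orders.\<close>

lemma (in group) parcs_OSCom_complete:
  assumes a: "a \<in> carrier G"
    and orders: "\<And>g. g \<in> carrier G \<Longrightarrow> \<exists>k::nat. ord (a [^] k) = ord g"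
  shows "parcs (OSCom G) = {(g, h). g \<in> carrier G \<and> h \<in> carrier G \<and> g \<noteq> h}"
proof -
  have "\<exists>g'\<in>carrier G. \<exists>h'\<in>carrier G. ord g' = ord g \<and> ord h' = ord h \<and> g' \<otimes> h' = h' \<otimes> g'"
    if gh: "g \<in> carrier G" "h \<in> carrier G" for g h
  proof -
    obtain k l :: nat where "ord (a [^] k) = ord g" "ord (a [^] l) = ord h"
      using orders gh by meson
    then show ?thesis
      using a nat_pow_comm[OF a, of k l] by (meson nat_pow_closed)
  qed
  then show ?thesis
    unfolding OSCom_def by auto
qed

lemma digraph_iso_complete_graph:
  assumes fin: "finite (pverts D)" and card: "card (pverts D) = r"
    and arcs: "parcs D = {(u, v). u \<in> pverts D \<and> v \<in> pverts D \<and> u \<noteq> v}"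
  shows "digraph_iso (with_proj D) (with_proj (complete_graph r))"
proof -
  obtain f where f: "bij_betw f (pverts D) {..<r}"
    using ex_bij_betw_finite_nat[OF fin] card by (auto simp: lessThan_atLeast0)
  then have inj: "inj_on f (pverts D)" and img: "f ` pverts D = {..<r}"
    by (auto simp: bij_betw_def)
  define F where
    "F = \<lparr>iso_verts = f, iso_arcs = map_prod f f, iso_head = snd, iso_tail = fst\<rparr>"
  have "wf_digraph (with_proj D)"
    by unfold_locales (auto simp: arcs)
  moreover have "inj_on (map_prod f f) (parcs D)"
    using map_prod_inj_on[OF inj inj] by (rule inj_on_subset) (auto simp: arcs)
  ultimately have "pre_digraph.digraph_isomorphism (with_proj D) F"
    using inj by (auto simp: pre_digraph.digraph_isomorphism_def F_def)
  moreover have "map_prod f f ` parcs D = {(i, j). i < r \<and> j < r \<and> i \<noteq> j}"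
  proof (intro Set.set_eqI iffI)
    fix p assume "p \<in> map_prod f f ` parcs D"
    then show "p \<in> {(i, j). i < r \<and> j < r \<and> i \<noteq> j}"
      using img inj by (auto simp: arcs dest: inj_onD)
  next
    fix p assume p: "p \<in> {(i, j). i < r \<and> j < r \<and> i \<noteq> j}"
    then have "p \<in> f ` pverts D \<times> f ` pverts D"
      by (auto simp: img)
    then obtain u v where "u \<in> pverts D" "v \<in> pverts D" "p = (f u, f v)"
      by auto
    with p show "p \<in> map_prod f f ` parcs D"
      by (auto simp: arcs intro!: image_eqI[where x = "(u, v)"])
  qed
  then have "with_proj (complete_graph r) = app_iso F (with_proj D)"
    by (simp add: app_iso_def F_def with_proj_def complete_graph_def img)
  ultimately show ?thesis
    by (auto simp: digraph_iso_def)
qed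

section \<open>A semidirect product of cyclic groups\<close>

text \<open>The pair \<open>(i, s)\<close> stands for \<open>a\<^sup>i b\<^sup>s\<close> in the semidirect product of a cyclic group of order
  \<open>m\<close> with a group \<open>{1, b}\<close> of order 2 in which conjugation with \<open>b\<close> raises \<open>a\<close> to the power \<open>c\<close>.\<close>

definition cyclic_semidirect :: "nat \<Rightarrow> nat \<Rightarrow> (nat \<times> nat) monoid" where
  "cyclic_semidirect m c =
    \<lparr>carrier = {..<m} \<times> {..<2},
     monoid.mult = (\<lambda>(i, s) (j, t). ((i + c ^ s * j) mod m, (s + t) mod 2)),
     one = (0, 0)\<rparr>"

lemma cyclic_semidirect_simps:
  "carrier (cyclic_semidirect m c) = {..<m} \<times> {..<2}"
  "(i, s) \<otimes>\<^bsub>cyclic_semidirect m c\<^esub> (j, t) = ((i + c ^ s * j) mod m, (s + t) mod 2)"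
  "\<one>\<^bsub>cyclic_semidirect m c\<^esub> = (0, 0)"
  by (simp_all add: cyclic_semidirect_def)

lemma group_cyclic_semidirect:
  assumes m: "m > 0" and c: "[c * c = 1] (mod m)"
  shows "group (cyclic_semidirect m c)"
proof (rule groupI)
  fix x y z
  assume "x \<in> carrier (cyclic_semidirect m c)" "y \<in> carrier (cyclic_semidirect m c)"
    "z \<in> carrier (cyclic_semidirect m c)"
  then obtain i s j t k u where xyz: "x = (i, s)" "y = (j, t)" "z = (k, u)"
    and st: "s < 2" "t < 2"
    by (auto simp: cyclic_semidirect_simps)
  (* Only for s = t = 1 does the sum s + t wrap around, and there c * c = 1 is what compensates. *)
  have "[c ^ ((s + t) mod 2) = c ^ s * c ^ t] (mod m)"
    using st c by (auto simp: less_2_cases_iff cong_sym)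
  then have "[i + c ^ s * j + c ^ ((s + t) mod 2) * k = i + c ^ s * j + c ^ s * c ^ t * k] (mod m)"
    by (intro cong_add cong_mult cong_refl)
  also have "i + c ^ s * j + c ^ s * c ^ t * k = i + c ^ s * (j + c ^ t * k)"
    by (simp add: algebra_simps)
  also have "[\<dots> = i + c ^ s * ((j + c ^ t * k) mod m)] (mod m)"
    by (intro cong_add cong_mult cong_refl) (simp add: cong_def)
  finally have "((i + c ^ s * j) mod m + c ^ ((s + t) mod 2) * k) mod m
      = (i + c ^ s * ((j + c ^ t * k) mod m)) mod m"
    by (simp add: cong_def mod_add_left_eq)
  then show "x \<otimes>\<^bsub>cyclic_semidirect m c\<^esub> y \<otimes>\<^bsub>cyclic_semidirect m c\<^esub> z =
      x \<otimes>\<^bsub>cyclic_semidirect m c\<^esub> (y \<otimes>\<^bsub>cyclic_semidirect m c\<^esub> z)"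
    by (simp add: xyz cyclic_semidirect_simps mod_add_left_eq mod_add_right_eq add.assoc)
next
  fix x assume "x \<in> carrier (cyclic_semidirect m c)"
  then obtain i s where x: "x = (i, s)" and i: "i < m" and s: "s < 2"
    by (auto simp: cyclic_semidirect_simps)
  (* The inverse of a^i b^s is b^s a^(m - i) = a^(c^s (m - i)) b^s. *)
  define y where "y = (c ^ s * (m - i) mod m, s)"
  have "c ^ s * (m - i) + c ^ s * i = c ^ s * m"
    using i by (simp flip: add_mult_distrib2)
  then have "(c ^ s * (m - i) + c ^ s * i) mod m = 0"
    by simp
  then have "y \<otimes>\<^bsub>cyclic_semidirect m c\<^esub> x = \<one>\<^bsub>cyclic_semidirect m c\<^esub>"
    using s by (auto simp: x y_def cyclic_semidirect_simps mod_simps less_2_cases_iff)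
  moreover have "y \<in> carrier (cyclic_semidirect m c)"
    using m s by (simp add: y_def cyclic_semidirect_simps)
  ultimately show "\<exists>y\<in>carrier (cyclic_semidirect m c).
      y \<otimes>\<^bsub>cyclic_semidirect m c\<^esub> x = \<one>\<^bsub>cyclic_semidirect m c\<^esub>"
    by blast
qed (use m in \<open>auto simp: cyclic_semidirect_simps\<close>)

lemma cyclic_semidirect_pow:
  assumes "m > 1"
  shows "(1, 0) [^]\<^bsub>cyclic_semidirect m c\<^esub> k = (k mod m, 0)"
  by (induction k) (use assms in \<open>simp_all add: cyclic_semidirect_simps mod_simps nat_pow_def\<close>)

section \<open>Normal forms in the semidihedral group\<close>

lemma (in group) word_value_replicate:
  assumes "f x \<in> carrier G"
  shows "word_value G f (replicate k (x, True)) = f x [^] k"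
proof (induction k)
  case (Suc k)
  then show ?case
    by (simp only: nat_pow_Suc2[OF assms]) simp
qed simp

lemma word_class_replicate:
  "word_class R (replicate k p) = word_class R [p] [^]\<^bsub>presented_group R\<^esub> k"
proof (induction k)
  case (Suc k)
  interpret group "presented_group R"
    by (rule group_presented_group)
  have p: "word_class R [p] \<in> carrier (presented_group R)"
    by (simp add: presented_group_simps)
  have "word_class R (replicate (Suc k) p) =
      word_class R [p] \<otimes>\<^bsub>presented_group R\<^esub> word_class R (replicate k p)"
    by (simp add: presented_group_simps)
  then show ?case
    by (simp only: Suc.IH nat_pow_Suc2[OF p])
qed (simp add: presented_group_simps)

lemma presented_group_rel:
  "(u, v) \<in> R \<Longrightarrow> word_class R u = word_class R v"
  by (simp add: word_class_eq_iff word_cong.rel)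

lemma word_class_inverse_letter:
  "word_class R [(x, False)] = inv\<^bsub>presented_group R\<^esub> word_class R [(x, True)]"
proof -
  interpret group "presented_group R"
    by (rule group_presented_group)
  have "word_class R [(x, False), (x, True)] = word_class R []"
    using word_cong.cancel[of R x False] by (simp add: word_class_eq_iff)
  then show ?thesis
    by (intro inv_equality[symmetric]) (simp_all add: presented_group_simps)
qed

lemma (in group) conj_pow:
  assumes "a \<in> carrier G" "b \<in> carrier G" and ba: "b \<otimes> a = a [^] (c::nat) \<otimes> b"
  shows "b \<otimes> a [^] (k::nat) = a [^] (c * k) \<otimes> b"
proof (induction k)
  case (Suc k)
  have "b \<otimes> a [^] Suc k = (b \<otimes> a [^] k) \<otimes> a"
    using assms by (simp add: m_assoc)
  also have "\<dots> = a [^] (c * k) \<otimes> (b \<otimes> a)"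
    using assms by (simp add: Suc.IH m_assoc)
  also have "\<dots> = (a [^] (c * k) \<otimes> a [^] c) \<otimes> b"
    using assms by (simp add: ba m_assoc)
  also have "\<dots> = a [^] (c * Suc k) \<otimes> b"
    using assms by (simp add: nat_pow_mult add.commute)
  finally show ?case .
qed (use assms in simp)

lemma group_semidihedral: "group (semidihedral n)"
  by (simp add: semidihedral_def group_presented_group)

lemma semidihedral_generators:
  defines "a n \<equiv> word_class (sd_relations n) [(gen_a, True)]"
    and "b n \<equiv> word_class (sd_relations n) [(gen_b, True)]"
  shows "a n \<in> carrier (semidihedral n)" "b n \<in> carrier (semidihedral n)"
    and "a n [^]\<^bsub>semidihedral n\<^esub> (4 * n) = \<one>\<^bsub>semidihedral n\<^esub>"
    and "b n \<otimes>\<^bsub>semidihedral n\<^esub> b n = \<one>\<^bsub>semidihedral n\<^esub>"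
    and "b n \<otimes>\<^bsub>semidihedral n\<^esub> a n = a n [^]\<^bsub>semidihedral n\<^esub> (2 * n - 1) \<otimes>\<^bsub>semidihedral n\<^esub> b n"
proof -
  let ?R = "sd_relations n"
  interpret group "semidihedral n"
    by (rule group_semidihedral)
  note simps = presented_group_simps[of ?R, folded semidihedral_def]
  note pow = word_class_replicate[of ?R, folded semidihedral_def]
  show a: "a n \<in> carrier (semidihedral n)" and b: "b n \<in> carrier (semidihedral n)"
    by (simp_all add: a_def b_def simps)
  have "word_class ?R (replicate (4 * n) (gen_a, True)) = word_class ?R []"
    by (rule presented_group_rel) (simp add: sd_relations_def Let_def)
  then show "a n [^]\<^bsub>semidihedral n\<^esub> (4 * n) = \<one>\<^bsub>semidihedral n\<^esub>"
    by (simp only: a_def pow simps)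
  have "word_class ?R (replicate 2 (gen_b, True)) = word_class ?R []"
    by (rule presented_group_rel) (simp add: sd_relations_def Let_def)
  then show "b n \<otimes>\<^bsub>semidihedral n\<^esub> b n = \<one>\<^bsub>semidihedral n\<^esub>"
    by (simp add: b_def simps numeral_2_eq_2)
  have "word_class ?R [(gen_b, True), (gen_a, True), (gen_b, False)] =
      word_class ?R (replicate (2 * n - 1) (gen_a, True))"
    by (rule presented_group_rel) (simp add: sd_relations_def Let_def)
  moreover have "word_class ?R [(gen_b, True), (gen_a, True), (gen_b, False)] =
      b n \<otimes>\<^bsub>semidihedral n\<^esub> a n \<otimes>\<^bsub>semidihedral n\<^esub> inv\<^bsub>semidihedral n\<^esub> b n"
    by (simp add: a_def b_def simps
        flip: word_class_inverse_letter[of ?R, folded semidihedral_def])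
  ultimately show "b n \<otimes>\<^bsub>semidihedral n\<^esub> a n =
      a n [^]\<^bsub>semidihedral n\<^esub> (2 * n - 1) \<otimes>\<^bsub>semidihedral n\<^esub> b n"
    using a b by (metis a_def pow inv_closed inv_solve_right m_closed)
qed

text \<open>Conjugation with \<open>b\<close> is an involution on the powers of \<open>a\<close> because
  \<open>(2n - 1)\<^sup>2 = 4n(n - 1) + 1\<close>; this makes the semidirect product a group, and its pairs
  \<open>(1, 0)\<close> and \<open>(0, 1)\<close> satisfy the defining relations.\<close>

lemma semidihedral_model_hom:
  assumes n: "n \<ge> 2"
  obtains h where "h \<in> hom (semidihedral n) (cyclic_semidirect (4 * n) (2 * n - 1))"
    "h (word_class (sd_relations n) [(gen_a, True)]) = (1, 0)"
    "h (word_class (sd_relations n) [(gen_b, True)]) = (0, 1)"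
proof -
  let ?M = "cyclic_semidirect (4 * n) (2 * n - 1)"
  have "(2 * n - 1) * (2 * n - 1) = (n - 1) * (4 * n) + 1"
  proof -
    obtain k where "n = Suc k" using n by (cases n) auto
    then show ?thesis by (simp add: algebra_simps)
  qed
  then have "[(2 * n - 1) * (2 * n - 1) = 1] (mod 4 * n)"
    by (simp only: cong_def mod_mult_self3)
  then interpret M: group ?M
    using n by (intro group_cyclic_semidirect) auto
  define f :: "sd_gen \<Rightarrow> nat \<times> nat"
    where "f x = (case x of gen_a \<Rightarrow> (1, 0) | gen_b \<Rightarrow> (0, 1))" for x
  have f: "range f \<subseteq> carrier ?M"
    using n by (auto simp: f_def cyclic_semidirect_simps split: sd_gen.splits)
  then have fx: "f x \<in> carrier ?M" for x
    by auto
  have pow: "word_value ?M f (replicate k (gen_a, True)) = (k mod (4 * n), 0)" for k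
    using n M.word_value_replicate[of f gen_a, OF fx] cyclic_semidirect_pow[of "4 * n" "2 * n - 1" k]
    by (simp add: f_def)
  have inv_b: "inv\<^bsub>?M\<^esub> (0, 1) = (0, 1)"
    using n by (intro M.inv_equality) (auto simp: cyclic_semidirect_simps)
  have "word_value ?M f u = word_value ?M f v" if "(u, v) \<in> sd_relations n" for u v
    using that n pow[of "4 * n"] pow[of "2 * n - 1"] inv_b
    by (auto simp: sd_relations_def Let_def f_def cyclic_semidirect_simps numeral_2_eq_2)
  then obtain h where h: "h \<in> hom (presented_group (sd_relations n)) ?M"
    and hf: "\<And>x. h (word_class (sd_relations n) [(x, True)]) = f x"
    using M.presented_group_hom[OF f, of "sd_relations n"] by blast
  show thesis
    by (rule that[of h]) (use h in \<open>simp_all add: hf f_def semidihedral_def\<close>)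
qed

text \<open>The normal forms exhaust the group because left multiplication with a generator or its inverse
  permutes them: \<open>b\<close> moves past \<open>a\<^sup>i\<close> at the price of the exponent \<open>(2n - 1)i\<close>. They are distinct
  because the homomorphism to the semidirect product sends \<open>a\<^sup>i b\<^sup>s\<close> to \<open>(i, s)\<close>.\<close>

lemma semidihedral_normal_form:
  assumes n: "n \<ge> 2"
  defines "G \<equiv> semidihedral n"
  defines "a \<equiv> word_class (sd_relations n) [(gen_a, True)]"
    and "b \<equiv> word_class (sd_relations n) [(gen_b, True)]"
  shows "bij_betw (\<lambda>(i::nat, s::nat). a [^]\<^bsub>G\<^esub> i \<otimes>\<^bsub>G\<^esub> b [^]\<^bsub>G\<^esub> s) ({..<4 * n} \<times> {..<2}) (carrier G)"
proof -
  interpret group G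
    unfolding G_def by (rule group_semidihedral)
  let ?R = "sd_relations n" and ?N = "\<lambda>(i::nat, s::nat). a [^]\<^bsub>G\<^esub> i \<otimes>\<^bsub>G\<^esub> b [^]\<^bsub>G\<^esub> s"
  let ?S = "?N ` ({..<4 * n} \<times> {..<2})"
  note gens = semidihedral_generators[of n, folded G_def a_def b_def]
  note [simp] = gens(1,2)
  note simps = presented_group_simps[of ?R, folded semidihedral_def G_def]
  have in_S: "a [^]\<^bsub>G\<^esub> i \<otimes>\<^bsub>G\<^esub> b [^]\<^bsub>G\<^esub> s \<in> ?S" for i s :: nat
  proof -
    have "a [^]\<^bsub>G\<^esub> i = a [^]\<^bsub>G\<^esub> (4 * n * (i div (4 * n)) + i mod (4 * n))"
      by simp
    also have "\<dots> = a [^]\<^bsub>G\<^esub> (i mod (4 * n))"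
      by (simp only: nat_pow_mult[symmetric] nat_pow_pow[symmetric] gens) simp
    finally have i: "a [^]\<^bsub>G\<^esub> i = a [^]\<^bsub>G\<^esub> (i mod (4 * n))" .
    have "b [^]\<^bsub>G\<^esub> (2::nat) = \<one>\<^bsub>G\<^esub>"
      by (simp add: gens numeral_2_eq_2)
    moreover have "b [^]\<^bsub>G\<^esub> s = b [^]\<^bsub>G\<^esub> (2 * (s div 2) + s mod 2)"
      by simp
    ultimately have s: "b [^]\<^bsub>G\<^esub> s = b [^]\<^bsub>G\<^esub> (s mod 2)"
      by (simp only: nat_pow_mult[symmetric] nat_pow_pow[symmetric] gens) simp
    show ?thesis
      by (subst i, subst s, rule image_eqI[where x = "(i mod (4 * n), s mod 2)"]) (use n in auto)
  qed
  have mult_a: "a [^]\<^bsub>G\<^esub> k \<otimes>\<^bsub>G\<^esub> x \<in> ?S" if x: "x \<in> ?S" for k :: nat and x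
  proof -
    obtain i s where "x = a [^]\<^bsub>G\<^esub> (i::nat) \<otimes>\<^bsub>G\<^esub> b [^]\<^bsub>G\<^esub> (s::nat)"
      using x by auto
    then have "a [^]\<^bsub>G\<^esub> k \<otimes>\<^bsub>G\<^esub> x = a [^]\<^bsub>G\<^esub> (k + i) \<otimes>\<^bsub>G\<^esub> b [^]\<^bsub>G\<^esub> s"
      by (simp add: m_assoc nat_pow_mult[symmetric])
    then show ?thesis
      by (simp only: in_S)
  qed
  have mult_b: "b \<otimes>\<^bsub>G\<^esub> x \<in> ?S" if x: "x \<in> ?S" for x
  proof -
    obtain i s where "x = a [^]\<^bsub>G\<^esub> (i::nat) \<otimes>\<^bsub>G\<^esub> b [^]\<^bsub>G\<^esub> (s::nat)"
      using x by auto
    then have "b \<otimes>\<^bsub>G\<^esub> x = (b \<otimes>\<^bsub>G\<^esub> a [^]\<^bsub>G\<^esub> i) \<otimes>\<^bsub>G\<^esub> b [^]\<^bsub>G\<^esub> s"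
      by (simp add: m_assoc)
    also have "\<dots> = a [^]\<^bsub>G\<^esub> ((2 * n - 1) * i) \<otimes>\<^bsub>G\<^esub> b [^]\<^bsub>G\<^esub> Suc s"
      by (simp only: conj_pow[OF gens(1,2,5)] nat_pow_Suc2[OF gens(2)]) (simp add: m_assoc)
    finally show ?thesis
      by (simp only: in_S)
  qed
  (* A positive power of each generator is trivial, so formal inverses are positive words too. *)
  have inv_a: "inv\<^bsub>G\<^esub> a = a [^]\<^bsub>G\<^esub> (4 * n - 1)"
  proof (rule inv_equality)
    have "a [^]\<^bsub>G\<^esub> Suc (4 * n - 1) = \<one>\<^bsub>G\<^esub>"
      using n gens(3) by simp
    then show "a [^]\<^bsub>G\<^esub> (4 * n - 1) \<otimes>\<^bsub>G\<^esub> a = \<one>\<^bsub>G\<^esub>"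
      by simp
  qed auto
  have inv_b: "inv\<^bsub>G\<^esub> b = b"
    by (rule inv_equality) (auto simp: gens)
  have "word_class ?R u \<in> ?S" for u
  proof (induction u)
    case Nil
    then show ?case
      using in_S[of 0 0] by (simp add: simps)
  next
    case (Cons p u)
    have "word_class ?R [p] \<in> {a [^]\<^bsub>G\<^esub> (1::nat), a [^]\<^bsub>G\<^esub> (4 * n - 1), b}"
    proof (cases p)
      case (Pair x s)
      then show ?thesis
        using word_class_inverse_letter[of ?R x, folded semidihedral_def G_def] inv_a inv_b
        by (cases x; cases s) (auto simp: a_def b_def nat_pow_eone simps)
    qed
    then have "word_class ?R [p] \<otimes>\<^bsub>G\<^esub> word_class ?R u \<in> ?S"
      using mult_a[OF Cons.IH] mult_b[OF Cons.IH] by (elim insertE emptyE) (simp_all only:)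
    then show ?case
      by (simp add: simps)
  qed
  then have "carrier G \<subseteq> ?S"
    by (auto simp: simps)
  moreover have "?S \<subseteq> carrier G"
    by auto
  moreover have "inj_on ?N ({..<4 * n} \<times> {..<2})"
  proof -
    let ?M = "cyclic_semidirect (4 * n) (2 * n - 1)"
    obtain h where h: "h \<in> hom G ?M" "h a = (1, 0)" "h b = (0, 1)"
      using semidihedral_model_hom[OF n] unfolding G_def a_def b_def by metis
    have one: "h \<one>\<^bsub>G\<^esub> = (0, 0)"
      using hom_mult[OF h(1) gens(2) gens(2)] by (simp add: gens(4) h cyclic_semidirect_simps)
    have pow_a: "h (a [^]\<^bsub>G\<^esub> k) = (k mod (4 * n), 0)" for k :: nat
      by (induction k) (use n in \<open>simp_all add: one hom_mult[OF h(1)] h cyclic_semidirect_simps mod_simps\<close>)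
    have pow_b: "h (b [^]\<^bsub>G\<^esub> s) = (0, s)" if "s < 2" for s :: nat
      using that by (auto simp: less_2_cases_iff one h)
    have "h (?N p) = p" if "p \<in> {..<4 * n} \<times> {..<2}" for p
      using that by (auto simp: hom_mult[OF h(1)] pow_a pow_b cyclic_semidirect_simps)
    then show ?thesis
      by (rule inj_on_inverseI)
  qed
  ultimately show ?thesis
    by (auto simp: bij_betw_def)
qed

section \<open>Element orders\<close>

lemma (in group) ord_eq_prime_power:
  assumes p: "prime (p::nat)" and x: "x \<in> carrier G"
    and "x [^] (p ^ k) \<noteq> \<one>" "x [^] (p ^ Suc k) = \<one>"
  shows "ord x = p ^ Suc k"
proof -
  have "ord x dvd p ^ Suc k" "\<not> ord x dvd p ^ k"
    using assms pow_eq_id[OF x] by auto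
  then obtain j where "ord x = p ^ j" "j \<le> Suc k" "\<not> j \<le> k"
    by (metis divides_primepow_nat[OF p] le_imp_power_dvd)
  then show ?thesis
    by (simp add: le_Suc_eq)
qed

text \<open>Outside the powers of \<open>a\<close>, the square \<open>(a\<^sup>i b)\<^sup>2 = a\<^bsup>2ni\<^esup>\<close> depends only on the parity of
  \<open>i\<close>: it is \<open>1\<close> or the involution \<open>a\<^bsup>2n\<^esup>\<close>, so \<open>a\<^sup>i b\<close> has the order of \<open>a\<^bsup>2n\<^esup>\<close> or of \<open>a\<^sup>n\<close>.\<close>

lemma semidihedral_ord_eq_ord_pow:
  assumes n: "n \<ge> 2"
  defines "G \<equiv> semidihedral n" and "a \<equiv> word_class (sd_relations n) [(gen_a, True)]"
  assumes g: "g \<in> carrier G"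
  shows "\<exists>k::nat. group.ord G (a [^]\<^bsub>G\<^esub> k) = group.ord G g"
proof -
  interpret group G
    unfolding G_def by (rule group_semidihedral)
  define b where "b = word_class (sd_relations n) [(gen_b, True)]"
  note gens = semidihedral_generators[of n, folded G_def a_def b_def]
  note [simp] = gens(1,2)
  note nf = semidihedral_normal_form[OF n, folded G_def a_def b_def]
  have inj: "i = j \<and> s = t"
    if "a [^]\<^bsub>G\<^esub> i \<otimes>\<^bsub>G\<^esub> b [^]\<^bsub>G\<^esub> s = a [^]\<^bsub>G\<^esub> j \<otimes>\<^bsub>G\<^esub> b [^]\<^bsub>G\<^esub> t" "i < 4 * n" "j < 4 * n" "s < 2" "t < 2"
    for i j s t :: nat
    using inj_onD[OF bij_betw_imp_inj_on[OF nf], of "(i, s)" "(j, t)"] that by auto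
  have a2n: "a [^]\<^bsub>G\<^esub> (2 * n) \<noteq> \<one>\<^bsub>G\<^esub>"
    using inj[of "2 * n" 0 0 0] n by auto
  obtain i s :: nat where g_eq: "g = a [^]\<^bsub>G\<^esub> i \<otimes>\<^bsub>G\<^esub> b [^]\<^bsub>G\<^esub> s" and i: "i < 4 * n" and s: "s < 2"
    using g unfolding bij_betw_imp_surj_on[OF nf, symmetric] by (elim imageE SigmaE) simp
  show ?thesis
  proof (cases "s = 0")
    case True
    then show ?thesis
      using g_eq by (intro exI[of _ i]) simp
  next
    case False
    with s g_eq have gb: "g = a [^]\<^bsub>G\<^esub> i \<otimes>\<^bsub>G\<^esub> b"
      by (cases "s = 1") auto
    have "g \<otimes>\<^bsub>G\<^esub> g = a [^]\<^bsub>G\<^esub> i \<otimes>\<^bsub>G\<^esub> (b \<otimes>\<^bsub>G\<^esub> a [^]\<^bsub>G\<^esub> i) \<otimes>\<^bsub>G\<^esub> b"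
      by (simp add: gb m_assoc)
    also have "\<dots> = a [^]\<^bsub>G\<^esub> i \<otimes>\<^bsub>G\<^esub> a [^]\<^bsub>G\<^esub> ((2 * n - 1) * i) \<otimes>\<^bsub>G\<^esub> (b \<otimes>\<^bsub>G\<^esub> b)"
      by (simp only: conj_pow[OF gens(1,2,5)]) (simp add: m_assoc)
    also have "\<dots> = a [^]\<^bsub>G\<^esub> (i + (2 * n - 1) * i)"
      by (simp add: gens nat_pow_mult)
    also have "i + (2 * n - 1) * i = 2 * n * i"
      using n by (cases n) (simp_all add: algebra_simps)
    finally have sq: "g [^]\<^bsub>G\<^esub> (2::nat) = a [^]\<^bsub>G\<^esub> (2 * n * i)"
      using g by (simp add: numeral_2_eq_2)
    show ?thesis
    proof (cases "even i")
      case True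
      then obtain j where j: "i = 2 * j" by blast
      have "g [^]\<^bsub>G\<^esub> (2::nat) = (a [^]\<^bsub>G\<^esub> (4 * n)) [^]\<^bsub>G\<^esub> j"
        by (simp add: sq j nat_pow_pow mult.assoc)
      then have "g [^]\<^bsub>G\<^esub> (2::nat) = \<one>\<^bsub>G\<^esub>"
        by (simp add: gens)
      moreover have "g \<noteq> \<one>\<^bsub>G\<^esub>"
        using inj[of i 1 0 0] i gb by auto
      ultimately have "ord g = 2"
        using ord_eq_prime_power[of 2 g 0] g by (simp add: nat_pow_eone)
      moreover have "ord (a [^]\<^bsub>G\<^esub> (2 * n)) = 2"
        using ord_eq_prime_power[of 2 "a [^]\<^bsub>G\<^esub> (2 * n)" 0] a2n gens(3)
        by (simp add: nat_pow_eone nat_pow_pow mult.commute)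
      ultimately show ?thesis
        by metis
    next
      case False
      then obtain j where j: "i = 2 * j + 1" by (rule oddE)
      have "g [^]\<^bsub>G\<^esub> (2::nat) = a [^]\<^bsub>G\<^esub> (4 * n * j + 2 * n)"
        by (simp add: sq j algebra_simps)
      also have "\<dots> = (a [^]\<^bsub>G\<^esub> (4 * n)) [^]\<^bsub>G\<^esub> j \<otimes>\<^bsub>G\<^esub> a [^]\<^bsub>G\<^esub> (2 * n)"
        by (simp add: nat_pow_pow nat_pow_mult)
      finally have g2: "g [^]\<^bsub>G\<^esub> (2::nat) = a [^]\<^bsub>G\<^esub> (2 * n)"
        by (simp add: gens)
      have "g [^]\<^bsub>G\<^esub> (4::nat) = (g [^]\<^bsub>G\<^esub> (2::nat)) [^]\<^bsub>G\<^esub> (2::nat)"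
        using g by (simp add: nat_pow_pow)
      also have "\<dots> = a [^]\<^bsub>G\<^esub> (4 * n)"
        by (simp add: g2 nat_pow_pow mult.commute)
      finally have "g [^]\<^bsub>G\<^esub> (4::nat) = \<one>\<^bsub>G\<^esub>"
        by (simp add: gens)
      with g2 have "ord g = 4"
        using ord_eq_prime_power[of 2 g 1] g a2n by simp
      moreover have "ord (a [^]\<^bsub>G\<^esub> n) = 4"
        using ord_eq_prime_power[of 2 "a [^]\<^bsub>G\<^esub> n" 1] a2n gens(3)
        by (simp add: nat_pow_pow mult.commute)
      ultimately show ?thesis
        by metis
    qed
  qed
qed

theorem theorem2p14:
  fixes n :: nat
  assumes "n \<ge> 2"
  shows "digraph_iso (with_proj (OSCom (semidihedral n))) (with_proj (complete_graph (8 * n)))"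
proof (rule digraph_iso_complete_graph)
  interpret group "semidihedral n"
    by (rule group_semidihedral)
  note nf = semidihedral_normal_form[OF assms]
  have V: "pverts (OSCom (semidihedral n)) = carrier (semidihedral n)"
    by (simp add: OSCom_def)
  show "finite (pverts (OSCom (semidihedral n)))"
    using bij_betw_finite[OF nf] by (simp add: V)
  show "card (pverts (OSCom (semidihedral n))) = 8 * n"
    using bij_betw_same_card[OF nf] by (simp add: V)
  show "parcs (OSCom (semidihedral n)) =
      {(u, v). u \<in> pverts (OSCom (semidihedral n)) \<and> v \<in> pverts (OSCom (semidihedral n)) \<and> u \<noteq> v}"
    unfolding V using semidihedral_generators(1) semidihedral_ord_eq_ord_pow[OF assms]
    by (rule parcs_OSCom_complete)
qed

end
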